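(* Let $\mathsf{UNI}$ be a matroid secretary algorithm which, for every $r>25$ and every $n$, is $(1-\tfrac{5}{\sqrt r})^{-1}$-competitive for the uniform matroid $U_{r,n}$. Let $\mathsf{PAV}$ be the algorithm that, given a weighted paving matroid $(M,w)$ of rank $r>26$, returns the output of $\mathsf{UNI}$ run on the weighted uniform matroid $(T(M),w)$ of rank $r-1$. Then $\mathsf{PAV}$ is $(1-\tfrac{6}{\sqrt r})^{-1}$-competitive for every paving matroid of rank $r\ge 37$.
   Context: A rank-$r$ matroid is paving if all its circuits have cardinality at least $r$. For a matroid $M$ of rank $r$, its truncation $T(M)$ is the matroid on $E(M)$ whose independent sets are the independent sets of $M$ of size at most $r-1$; $M$ is paving if and only if $T(M)$ is a uniform matroid. $U_{r,n}$ is the uniform matroid of rank $r$ on $n$ elements (all $r$-subsets are bases). Matroid secretary problem: a matroid $M$ with ground set $E$ is known in advance; an unknown weight function $w\colon E\to\mathbb{R}_{\ge 0}$ is given. The elements of $E$ are revealed one at a time in a uniformly random order; when an element $f$ is revealed, $w(f)$ is learned and the algorithm must irrevocably decide whether to select $f$, subject to the selected set always being independent in $M$. The algorithm may use internal randomness. The value of the algorithm on $(M,w)$ is the expected weight of the selected set (over the random order and internal randomness). $\mathrm{opt}(M,w)$ is the maximum weight of an independent set of $M$. For $c\ge1$, an algorithm is $c$-competitive for $M$ if its value is at least $\tfrac1c\mathrm{opt}(M,w)$ for every $w$. *)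

theory Defs
  imports "HOL-Probability.Probability" "HOL-Combinatorics.Multiset_Permutations"
begin

section \<open>Matroids\<close>

record 'a matroid =
  ground :: "'a set"
  indeps :: "'a set set"

definition is_matroid :: "'a matroid \<Rightarrow> bool" where
  "is_matroid M \<longleftrightarrow>
     finite (ground M) \<and>
     indeps M \<subseteq> Pow (ground M) \<and>
     {} \<in> indeps M \<and>
     (\<forall>X Y. Y \<in> indeps M \<and> X \<subseteq> Y \<longrightarrow> X \<in> indeps M) \<and>
     (\<forall>X Y. X \<in> indeps M \<and> Y \<in> indeps M \<and> card X < card Y \<longrightarrow>
        (\<exists>y \<in> Y - X. insert y X \<in> indeps M))"

definition matroid_rank :: "'a matroid \<Rightarrow> nat" where
  "matroid_rank M = Max (card ` indeps M)"

definition basis :: "'a matroid \<Rightarrow> 'a set \<Rightarrow> bool" where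
  "basis M B \<longleftrightarrow> B \<in> indeps M \<and> (\<forall>X \<in> indeps M. B \<subseteq> X \<longrightarrow> X = B)"

definition circuit :: "'a matroid \<Rightarrow> 'a set \<Rightarrow> bool" where
  "circuit M C \<longleftrightarrow> C \<subseteq> ground M \<and> C \<notin> indeps M \<and> (\<forall>X. X \<subset> C \<longrightarrow> X \<in> indeps M)"

definition paving_matroid :: "'a matroid \<Rightarrow> bool" where
  "paving_matroid M \<longleftrightarrow> is_matroid M \<and> (\<forall>C. circuit M C \<longrightarrow> matroid_rank M \<le> card C)"

definition truncation :: "'a matroid \<Rightarrow> 'a matroid" where
  "truncation M = \<lparr>ground = ground M, indeps = {X \<in> indeps M. card X \<le> matroid_rank M - 1}\<rparr>"

text \<open>\<open>uniform_matroid r n M\<close> says that \<open>M\<close> is a copy of $U_{r,n}$ on its ground set;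
  the rank condition forces \<open>r \<le> n\<close>.\<close>

definition uniform_matroid :: "nat \<Rightarrow> nat \<Rightarrow> 'a matroid \<Rightarrow> bool" where
  "uniform_matroid r n M \<longleftrightarrow>
     is_matroid M \<and> matroid_rank M = r \<and> card (ground M) = n \<and>
     (\<forall>X. X \<subseteq> ground M \<and> card X = r \<longrightarrow> basis M X)"


section \<open>The matroid secretary problem\<close>

text \<open>A randomised online rule draws a seed from the probability space \<open>seeds\<close> once. Then
  \<open>accept\<close> decides about each element on its arrival, as a function of the seed and of the
  list of elements revealed so far with their weights, the current element being the last entry.
  Earlier decisions need not be passed: they are determined by the seed and the prefixes of
  this list. A matroid secretary algorithm is a function from matroids to such rules, since the
  matroid is known in advance.\<close>

record ('a, 's) online_rule =
  seeds :: "'s measure"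
  accept :: "'s \<Rightarrow> ('a \<times> real) list \<Rightarrow> bool"

type_synonym ('a, 's) secretary_algorithm = "'a matroid \<Rightarrow> ('a, 's) online_rule"

definition weighting :: "'a matroid \<Rightarrow> ('a \<Rightarrow> real) \<Rightarrow> bool" where
  "weighting M w \<longleftrightarrow> (\<forall>x \<in> ground M. 0 \<le> w x)"

text \<open>The list \<open>xs\<close> is the order of arrival.\<close>

definition selected ::
  "('a, 's) online_rule \<Rightarrow> ('a \<Rightarrow> real) \<Rightarrow> 's \<Rightarrow> 'a list \<Rightarrow> 'a set" where
  "selected A w \<omega> xs =
     {xs ! i | i. i < length xs \<and> accept A \<omega> (map (\<lambda>x. (x, w x)) (take (Suc i) xs))}"

definition feasible :: "'a matroid \<Rightarrow> ('a, 's) online_rule \<Rightarrow> bool" where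
  "feasible M A \<longleftrightarrow>
     prob_space (seeds A) \<and>
     (\<forall>h. Measurable.pred (seeds A) (\<lambda>\<omega>. accept A \<omega> h)) \<and>
     (\<forall>w. weighting M w \<longrightarrow>
        (\<forall>xs \<in> permutations_of_set (ground M). \<forall>\<omega> \<in> space (seeds A).
           selected A w \<omega> xs \<in> indeps M))"

text \<open>The order of arrival is uniformly random and independent of the seed.\<close>

definition val :: "'a matroid \<Rightarrow> ('a \<Rightarrow> real) \<Rightarrow> ('a, 's) online_rule \<Rightarrow> real" where
  "val M w A =
     measure_pmf.expectation (pmf_of_set (permutations_of_set (ground M)))
       (\<lambda>xs. \<integral>\<omega>. (\<Sum>x \<in> selected A w \<omega> xs. w x) \<partial>seeds A)"

definition opt :: "'a matroid \<Rightarrow> ('a \<Rightarrow> real) \<Rightarrow> real" where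
  "opt M w = Max (sum w ` indeps M)"

definition competitive :: "real \<Rightarrow> 'a matroid \<Rightarrow> ('a, 's) secretary_algorithm \<Rightarrow> bool" where
  "competitive c M ALG \<longleftrightarrow>
     1 \<le> c \<and> feasible M (ALG M) \<and>
     (\<forall>w. weighting M w \<longrightarrow> val M w (ALG M) \<ge> 1 / c * opt M w)"

end

theory Submission
  imports Defs
begin

text \<open>Every set of size less than the rank \<open>r\<close> of a paving matroid is independent, so the
  truncation is uniform of rank \<open>r - 1\<close>. Removing the lightest element from an optimal set
  shows that truncating costs at most a factor \<open>1 - 1/r\<close> of the optimum, and
  \<open>(1 - 5/\<surd>(r - 1)) (1 - 1/r) \<ge> 1 - 6/\<surd>r\<close>.\<close>

section \<open>Independent sets, rank and circuits\<close>

lemma is_matroid_finite_ground: "is_matroid M \<Longrightarrow> finite (ground M)"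
  by (simp add: is_matroid_def)

lemma indep_subset_ground: "is_matroid M \<Longrightarrow> X \<in> indeps M \<Longrightarrow> X \<subseteq> ground M"
  by (auto simp: is_matroid_def)

lemma indep_finite: "is_matroid M \<Longrightarrow> X \<in> indeps M \<Longrightarrow> finite X"
  by (meson finite_subset indep_subset_ground is_matroid_finite_ground)

lemma indep_subset: "is_matroid M \<Longrightarrow> Y \<in> indeps M \<Longrightarrow> X \<subseteq> Y \<Longrightarrow> X \<in> indeps M"
  unfolding is_matroid_def by blast

lemma finite_indeps: "is_matroid M \<Longrightarrow> finite (indeps M)"
  unfolding is_matroid_def by (meson finite_Pow_iff finite_subset)

lemma indeps_nonempty: "is_matroid M \<Longrightarrow> indeps M \<noteq> {}"
  by (auto simp: is_matroid_def)

lemma card_indep_le_rank: "is_matroid M \<Longrightarrow> X \<in> indeps M \<Longrightarrow> card X \<le> matroid_rank M"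
  unfolding matroid_rank_def by (simp add: finite_indeps)

lemma obtain_indep_card_rank:
  assumes "is_matroid M"
  obtains B where "B \<in> indeps M" "card B = matroid_rank M"
proof -
  have "Max (card ` indeps M) \<in> card ` indeps M"
    using assms by (simp add: finite_indeps indeps_nonempty)
  then show thesis
    using that unfolding matroid_rank_def by auto
qed

text \<open>An inclusion-minimal dependent subset of \<open>X\<close> is a circuit; one exists
  because \<open>X\<close> is finite.\<close>

lemma dependent_contains_circuit:
  assumes "finite (ground M)" "X \<subseteq> ground M" "X \<notin> indeps M"
  obtains C where "C \<subseteq> X" "circuit M C"
proof -
  have "finite X"
    using assms finite_subset by blast
  then have fin: "finite {C. C \<subseteq> X \<and> C \<notin> indeps M}"
    by simp
  have "{C. C \<subseteq> X \<and> C \<notin> indeps M} \<noteq> {}"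
    using assms by auto
  from finite_has_minimal[OF fin this]
  obtain C where C: "C \<subseteq> X" "C \<notin> indeps M"
    and min: "\<forall>D \<in> {C. C \<subseteq> X \<and> C \<notin> indeps M}. D \<subseteq> C \<longrightarrow> C = D"
    by auto
  have "circuit M C"
    unfolding circuit_def
  proof (intro conjI allI impI)
    show "C \<subseteq> ground M"
      using C(1) assms(2) by (rule subset_trans)
    show "C \<notin> indeps M"
      by (fact C(2))
    fix D assume "D \<subset> C"
    then show "D \<in> indeps M"
      using min C(1) by auto
  qed
  with C(1) show thesis
    by (rule that)
qed

text \<open>If \<open>X\<close> were dependent, it would contain a circuit, and in a paving matroid
  that circuit alone has at least \<open>matroid_rank M\<close> elements.\<close>

lemma paving_small_indep:
  assumes M: "paving_matroid M" and X: "X \<subseteq> ground M" "card X < matroid_rank M"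
  shows "X \<in> indeps M"
proof (rule ccontr)
  assume "X \<notin> indeps M"
  have fin: "finite (ground M)"
    using M by (simp add: paving_matroid_def is_matroid_finite_ground)
  obtain C where C: "C \<subseteq> X" "circuit M C"
    using dependent_contains_circuit[OF fin X(1) \<open>X \<notin> indeps M\<close>] .
  have "matroid_rank M \<le> card C"
    using M C(2) by (simp add: paving_matroid_def)
  moreover have "card C \<le> card X"
    using C(1) X(1) fin by (meson card_mono finite_subset)
  ultimately show False
    using X(2) by simp
qed

section \<open>Truncation, and its uniformity for paving matroids\<close>

lemma ground_truncation [simp]: "ground (truncation M) = ground M"
  by (simp add: truncation_def)

lemma indeps_truncation:
  "X \<in> indeps (truncation M) \<longleftrightarrow> X \<in> indeps M \<and> card X \<le> matroid_rank M - 1"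
  by (simp add: truncation_def)

lemma is_matroid_truncation:
  assumes M: "is_matroid M"
  shows "is_matroid (truncation M)"
proof -
  have augment: "\<exists>y \<in> Y - X. insert y X \<in> indeps (truncation M)"
    if X: "X \<in> indeps (truncation M)" and Y: "Y \<in> indeps (truncation M)"
      and lt: "card X < card Y" for X Y
  proof -
    have "X \<in> indeps M" "Y \<in> indeps M"
      using X Y by (simp_all add: indeps_truncation)
    then obtain y where y: "y \<in> Y - X" "insert y X \<in> indeps M"
      using M lt unfolding is_matroid_def by blast
    \<comment> \<open>The augmented set is no larger than \<open>Y\<close>, which already obeys the
      size bound, so augmentation in \<open>M\<close> stays inside the truncation.\<close>
    have "card (insert y X) \<le> card Y"
      using lt card_insert_le_m1[of "card Y" X y] by linarith
    then show ?thesis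
      using y Y by (auto simp: indeps_truncation)
  qed
  have hereditary: "X \<in> indeps (truncation M)"
    if "Y \<in> indeps (truncation M)" "X \<subseteq> Y" for X Y
  proof -
    have Y: "Y \<in> indeps M" "card Y \<le> matroid_rank M - 1"
      using that by (simp_all add: indeps_truncation)
    then have "card X \<le> card Y"
      using that(2) indep_finite[OF M] by (simp add: card_mono)
    then show ?thesis
      using Y that(2) indep_subset[OF M] by (auto simp: indeps_truncation)
  qed
  show ?thesis
    unfolding is_matroid_def
  proof (intro conjI allI impI)
    show "finite (ground (truncation M))"
      using M by (simp add: is_matroid_finite_ground)
    show "indeps (truncation M) \<subseteq> Pow (ground (truncation M))"
      using indep_subset_ground[OF M] by (force simp: indeps_truncation)
    show "{} \<in> indeps (truncation M)"
      using M by (simp add: indeps_truncation is_matroid_def)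
  next
    fix X Y
    assume "Y \<in> indeps (truncation M) \<and> X \<subseteq> Y"
    then show "X \<in> indeps (truncation M)"
      using hereditary by blast
  next
    fix X Y
    assume "X \<in> indeps (truncation M) \<and> Y \<in> indeps (truncation M) \<and> card X < card Y"
    then show "\<exists>y \<in> Y - X. insert y X \<in> indeps (truncation M)"
      using augment by blast
  qed
qed

text \<open>A largest independent set minus one element attains the size bound. Subtraction on
  naturals covers rank 0 too: both sides are then 0.\<close>

lemma matroid_rank_truncation:
  assumes M: "is_matroid M"
  shows "matroid_rank (truncation M) = matroid_rank M - 1"
proof (rule antisym)
  note T = is_matroid_truncation[OF M]
  show "matroid_rank (truncation M) \<le> matroid_rank M - 1"
    by (rule obtain_indep_card_rank[OF T]) (simp add: indeps_truncation)
  obtain B where B: "B \<in> indeps M" "card B = matroid_rank M"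
    using obtain_indep_card_rank[OF M] .
  obtain C where C: "C \<subseteq> B" "card C = matroid_rank M - 1"
    using obtain_subset_with_card_n[of "matroid_rank M - 1" B] B(2) by auto
  have "C \<in> indeps (truncation M)"
    using indep_subset[OF M B(1) C(1)] C(2) by (simp add: indeps_truncation)
  then show "matroid_rank M - 1 \<le> matroid_rank (truncation M)"
    using card_indep_le_rank[OF T, of C] C(2) by simp
qed

lemma uniform_truncation_paving:
  assumes M: "paving_matroid M" and pos: "0 < matroid_rank M"
  shows "uniform_matroid (matroid_rank M - 1) (card (ground M)) (truncation M)"
proof -
  have mat: "is_matroid M"
    using M by (simp add: paving_matroid_def)
  have "basis (truncation M) X" if X: "X \<subseteq> ground M" "card X = matroid_rank M - 1" for X
    unfolding basis_def
  proof (intro conjI ballI impI)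
    show "X \<in> indeps (truncation M)"
      \<comment> \<open>Positive rank makes \<open>matroid_rank M - 1\<close> strictly smaller than
        the rank, as \<open>paving_small_indep\<close> demands.\<close>
      using paving_small_indep[OF M X(1)] X(2) pos by (simp add: indeps_truncation)
    fix Y assume Y: "Y \<in> indeps (truncation M)" "X \<subseteq> Y"
    then have "finite Y" "card Y \<le> card X"
      using indep_finite[OF mat] X(2) by (auto simp: indeps_truncation)
    with Y(2) show "Y = X"
      by (metis card_seteq)
  qed
  then show ?thesis
    using mat by (simp add: uniform_matroid_def is_matroid_truncation matroid_rank_truncation)
qed

section \<open>Loss in the optimum under truncation\<close>

lemma sum_remove_lightest:
  fixes w :: "'a \<Rightarrow> real"
  assumes "finite X" "X \<noteq> {}"
  obtains x where "x \<in> X" "(1 - 1 / real (card X)) * sum w X \<le> sum w (X - {x})"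
proof -
  obtain x where x: "x \<in> X" and le: "\<And>y. y \<in> X \<Longrightarrow> w x \<le> w y"
    using arg_min_if_finite(1)[OF assms, of w] arg_min_least[OF assms, of _ w] by blast
  \<comment> \<open>The minimum weight is at most the average, so removing \<open>x\<close> costs at
    most the fraction \<open>1 / card X\<close> of the total.\<close>
  have "real (card X) * w x \<le> sum w X"
    using le by (rule sum_bounded_below)
  then have "w x \<le> sum w X / real (card X)"
    using assms by (simp add: field_simps card_gt_0_iff)
  moreover have "sum w (X - {x}) = sum w X - w x"
    using assms x by (simp add: sum_diff1)
  ultimately have "(1 - 1 / real (card X)) * sum w X \<le> sum w (X - {x})"
    by (simp add: algebra_simps)
  with x show thesis
    by (rule that)
qed

lemma sum_indep_le_opt: "is_matroid M \<Longrightarrow> X \<in> indeps M \<Longrightarrow> sum w X \<le> opt M w"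
  unfolding opt_def by (simp add: finite_indeps)

text \<open>The empty set is independent and has weight 0.\<close>

lemma opt_nonneg: "is_matroid M \<Longrightarrow> 0 \<le> opt M w"
  using sum_indep_le_opt[of M "{}" w] by (simp add: is_matroid_def)

text \<open>An optimal set of full size becomes admissible for the truncation once its lightest
  element is dropped. A smaller optimal set is admissible as it stands, and then the factor, at most
  1, only weakens the bound since the optimum is nonnegative.\<close>

lemma opt_truncation_ge:
  assumes M: "is_matroid M" and pos: "0 < matroid_rank M"
  shows "(1 - 1 / real (matroid_rank M)) * opt M w \<le> opt (truncation M) w"
proof -
  let ?r = "matroid_rank M"
  note T = is_matroid_truncation[OF M]
  have "opt M w \<in> sum w ` indeps M"
    unfolding opt_def using M by (simp add: finite_indeps indeps_nonempty)
  then obtain X where X: "X \<in> indeps M" "opt M w = sum w X"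
    by auto
  show ?thesis
  proof (cases "card X = ?r")
    case True
    have "finite X" "X \<noteq> {}"
      using True pos indep_finite[OF M X(1)] by auto
    then obtain x where x: "x \<in> X" "(1 - 1 / real (card X)) * sum w X \<le> sum w (X - {x})"
      by (rule sum_remove_lightest)
    have "X - {x} \<in> indeps M"
      using indep_subset[OF M X(1)] by blast
    then have "X - {x} \<in> indeps (truncation M)"
      using x(1) True by (simp add: indeps_truncation)
    from sum_indep_le_opt[OF T this, of w] show ?thesis
      using x(2) X(2) True by simp
  next
    case False
    then have "card X < ?r"
      using card_indep_le_rank[OF M X(1)] by simp
    then have "X \<in> indeps (truncation M)"
      using X(1) by (simp add: indeps_truncation)
    from sum_indep_le_opt[OF T this, of w] have "opt M w \<le> opt (truncation M) w"
      using X(2) by simp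
    moreover have "(1 - 1 / real ?r) * opt M w \<le> 1 * opt M w"
      using opt_nonneg[OF M] by (intro mult_right_mono) auto
    ultimately show ?thesis
      by simp
  qed
qed

section \<open>Transfer of rules from the truncation to the matroid\<close>

lemma weighting_truncation [simp]: "weighting (truncation M) w \<longleftrightarrow> weighting M w"
  by (simp add: weighting_def)

text \<open>The matroid enters \<open>val\<close> only through its ground set, which truncation
  preserves.\<close>

lemma val_truncation [simp]: "val (truncation M) w A = val M w A"
  by (simp add: val_def)

text \<open>Arrival orders and weightings are the same for both matroids, and every set independent
  in the truncation is independent in \<open>M\<close>.\<close>

lemma feasible_of_truncation: "feasible (truncation M) A \<Longrightarrow> feasible M A"
  by (simp add: feasible_def indeps_truncation)

text \<open>Expanding the product leaves a nonnegative cross term, so it suffices to bound the sum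
  of the two losses by \<open>6 / sqrt r\<close>. This allowance is split as 11/2 for the ratio at
  rank \<open>r - 1\<close> and 1/2 for the truncation.\<close>

lemma paving_ratio_bound:
  fixes r :: real
  assumes r: "37 \<le> r"
  shows "1 - 6 / sqrt r \<le> (1 - 5 / sqrt (r - 1)) * (1 - 1 / r)"
proof -
  have pos: "0 < sqrt r" "0 < sqrt (r - 1)"
    using r by auto
  \<comment> \<open>The bound by \<open>(11 / 2) / sqrt r\<close> is equivalent to
    \<open>10 * sqrt r \<le> 11 * sqrt (r - 1)\<close>, which after squaring is
    \<open>100 * r \<le> 121 * (r - 1)\<close>.\<close>
  have "10 * sqrt r = sqrt (100 * r)"
    by (simp add: real_sqrt_mult)
  also have "\<dots> \<le> sqrt (121 * (r - 1))"
    using r by simp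
  also have "\<dots> = 11 * sqrt (r - 1)"
    by (simp only: real_sqrt_mult) simp
  finally have shift: "5 / sqrt (r - 1) \<le> (11 / 2) / sqrt r"
    using pos by (simp add: field_simps)
  \<comment> \<open>Here \<open>2 \<le> sqrt r\<close>; dividing by \<open>2 * r * sqrt r\<close>
    gives the bound on \<open>1 / r\<close>.\<close>
  have "2 * sqrt r \<le> sqrt r * sqrt r"
    using r pos by (intro mult_right_mono real_le_rsqrt) auto
  then have "1 / r \<le> (1 / 2) / sqrt r"
    using r pos by (simp add: field_simps)
  with shift have "5 / sqrt (r - 1) + 1 / r \<le> 6 / sqrt r"
    by (simp add: field_simps)
  moreover have "0 \<le> 5 / sqrt (r - 1) * (1 / r)"
    using r by simp
  moreover have "(1 - 5 / sqrt (r - 1)) * (1 - 1 / r) =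
      1 - (5 / sqrt (r - 1) + 1 / r) + 5 / sqrt (r - 1) * (1 / r)"
    by (simp only: algebra_simps)
  ultimately show ?thesis
    by linarith
qed

text \<open>A guarantee against \<open>opt (truncation M)\<close> turns into one against
  \<open>opt M\<close>: \<open>ALG'\<close> plays on \<open>M\<close> the very rule that
  \<open>ALG\<close> plays on the truncation, with equal value, and
  \<open>paving_ratio_bound\<close> absorbs the loss in the optimum.\<close>

lemma competitive_of_truncation:
  assumes M: "paving_matroid M" and r: "37 \<le> matroid_rank M"
    and comp: "competitive (inverse (1 - 5 / sqrt (real (matroid_rank M - 1)))) (truncation M) ALG"
    and eq: "ALG' M = ALG (truncation M)"
  shows "competitive (inverse (1 - 6 / sqrt (real (matroid_rank M)))) M ALG'"
proof -
  define r where "r = matroid_rank M"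
  define a where "a = 1 - 5 / sqrt (real r - 1)"
  have r37: "37 \<le> real r"
    using r by (simp add: r_def)
  have r1: "real (matroid_rank M - 1) = real r - 1"
    using r by (simp add: r_def of_nat_diff)
  have mat: "is_matroid M"
    using M by (simp add: paving_matroid_def)
  \<comment> \<open>This is where 37 comes from: it is the least integer whose square root exceeds
    6. The ratio is then positive, so its inverse is a competitive factor of at least 1.\<close>
  have "6 < sqrt (real r)"
    using r37 by (intro real_less_rsqrt) simp
  then have ratio: "0 < 1 - 6 / sqrt (real r)" "1 - 6 / sqrt (real r) \<le> 1"
    using r37 by (simp_all add: divide_less_eq)
  \<comment> \<open>Nonnegativity of \<open>a\<close> allows the bound on the truncated optimum to
    be multiplied by it.\<close>
  have "5 \<le> sqrt (real r - 1)"
    using r37 by (intro real_le_rsqrt) simp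
  then have a: "0 \<le> a"
    unfolding a_def using r37 by (subst diff_ge_0_iff_ge, subst pos_divide_le_eq) auto
  have "(1 - 6 / sqrt (real r)) * opt M w \<le> val M w (ALG' M)" if w: "weighting M w" for w
  proof -
    have "(1 - 6 / sqrt (real r)) * opt M w \<le> a * (1 - 1 / real r) * opt M w"
      unfolding a_def using paving_ratio_bound[OF r37] opt_nonneg[OF mat] by (rule mult_right_mono)
    also have "\<dots> = a * ((1 - 1 / real r) * opt M w)"
      by (simp only: mult.assoc)
    also have "\<dots> \<le> a * opt (truncation M) w"
      using opt_truncation_ge[OF mat] r a unfolding r_def by (intro mult_left_mono) auto
    also have "\<dots> \<le> val M w (ALG' M)"
      using comp w unfolding competitive_def r1 a_def eq by (simp add: inverse_eq_divide)
    finally show ?thesis .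
  qed
  moreover have "feasible M (ALG' M)"
    using comp unfolding competitive_def eq by (blast intro: feasible_of_truncation)
  moreover have "1 \<le> inverse (1 - 6 / sqrt (real r))"
    using ratio by (rule one_le_inverse)
  ultimately show ?thesis
    unfolding competitive_def r_def by (simp add: inverse_eq_divide)
qed

theorem theorem6p5:
  fixes UNI PAV :: "('a, 's) secretary_algorithm"
  assumes UNI: "\<And>r n U. r > 25 \<Longrightarrow> uniform_matroid r n U \<Longrightarrow>
                  competitive (inverse (1 - 5 / sqrt (real r))) U UNI"
    and PAV: "\<And>M. paving_matroid M \<Longrightarrow> matroid_rank M > 26 \<Longrightarrow> PAV M = UNI (truncation M)"
  shows "\<forall>r M. r \<ge> 37 \<and> paving_matroid M \<and> matroid_rank M = r \<longrightarrow>
           competitive (inverse (1 - 6 / sqrt (real r))) M PAV"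
proof (intro allI impI, elim conjE)
  fix r and M :: "'a matroid"
  assume r: "37 \<le> r" and M: "paving_matroid M" and rank: "matroid_rank M = r"
  have "competitive (inverse (1 - 5 / sqrt (real (matroid_rank M - 1)))) (truncation M) UNI"
    \<comment> \<open>The truncation is uniform of rank \<open>r - 1\<close>, which is at least 36
      and so within the range of the guarantee for \<open>UNI\<close>.\<close>
    using UNI[OF _ uniform_truncation_paving[OF M]] r rank by simp
  moreover have "PAV M = UNI (truncation M)"
    using PAV[OF M] r rank by simp
  ultimately show "competitive (inverse (1 - 6 / sqrt (real r))) M PAV"
    using competitive_of_truncation[OF M] r rank by blast
qed

end
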